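(* Every finite digraph $D$ has a feedback arc set $F\subseteq E(D)$ with the following properties: (i) $d_{G(D,F)}(v)\le \min\{d_D^+(v),d_D^-(v)\}$ for every $v\in V(D)$; (ii) if $I$ is an independent set of $G(D,F)$, then the induced subdigraph $D[I]$ is acyclic. Furthermore, such an $F$ can be found in polynomial time; that is, there is an algorithm which, given $D$ as input, outputs such a set $F$ in time polynomial in the size of $D$.
   Context: A digraph $D$ is a pair $(V(D),E(D))$ where $V(D)$ is a finite set and $E(D)\subseteq (V(D)\times V(D))\setminus\{(v,v):v\in V(D)\}$ (so there are no loops and no parallel arcs, but both $(u,v)$ and $(v,u)$ may be arcs). For $v\in V(D)$, $d_D^+(v)=|\{w:(v,w)\in E(D)\}|$ and $d_D^-(v)=|\{u:(u,v)\in E(D)\}|$. For $U\subseteq V(D)$, $D[U]$ is the subdigraph of $D$ induced by $U$. A directed cycle is a digraph with vertex set $\{u_1,\ldots,u_t\}$ (distinct vertices), $t\ge 2$, and arc set $\{(u_i,u_{i+1}):1\le i\le t-1\}\cup\{(u_t,u_1)\}$; in particular a pair of opposite arcs forms a directed cycle. A digraph is acyclic if it contains no directed cycle. A set $F\subseteq E(D)$ is a feedback arc set of $D$ if the digraph $D-F:=(V(D),E(D)\setminus F)$ is acyclic. For $F\subseteq E(D)$, $G(D,F)$ denotes the simple undirected graph on vertex set $V(D)$ with edge set $\{\{u,v\}:(u,v)\in F\text{ or }(v,u)\in F\}$, and $d_{G(D,F)}(v)$ is the degree of $v$ in this graph. *)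

theory Defs
  imports "Graph_Theory.Graph_Theory" "HOL-Computational_Algebra.Polynomial"
begin

text \<open>
  A digraph is a \<^typ>\<open>'a pair_pre_digraph\<close> satisfying the locale predicate
  \<^const>\<open>pair_digraph\<close>: finite, arcs are pairs of vertices, no loops. Opposite
  arcs are allowed, and since there are no loops every \<^const>\<open>pre_digraph.cycle\<close>
  has length at least 2.
\<close>

definition acyclic_digraph :: "('a, 'b) pre_digraph \<Rightarrow> bool" where
  "acyclic_digraph D \<longleftrightarrow> \<not> (\<exists>p. pre_digraph.cycle D p)"

definition feedback_arc_set :: "'a pair_pre_digraph \<Rightarrow> ('a \<times> 'a) set \<Rightarrow> bool" where
  "feedback_arc_set D F \<longleftrightarrow>
     F \<subseteq> parcs D \<and> acyclic_digraph (with_proj \<lparr>pverts = pverts D, parcs = parcs D - F\<rparr>)"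

text \<open>Undirected graphs are pairs of a vertex set and a set of two-element edges.\<close>

type_synonym 'a ugraph = "'a set \<times> 'a set set"

definition fas_graph :: "'a pair_pre_digraph \<Rightarrow> ('a \<times> 'a) set \<Rightarrow> 'a ugraph" where
  "fas_graph D F = (pverts D, {{u, v} | u v. (u, v) \<in> F \<or> (v, u) \<in> F})"

definition ugraph_degree :: "'a ugraph \<Rightarrow> 'a \<Rightarrow> nat" where
  "ugraph_degree G v = card {e \<in> snd G. v \<in> e}"

definition independent_set :: "'a ugraph \<Rightarrow> 'a set \<Rightarrow> bool" where
  "independent_set G I \<longleftrightarrow> I \<subseteq> fst G \<and> (\<forall>u\<in>I. \<forall>v\<in>I. {u, v} \<notin> snd G)"

definition sparse_feedback_arc_set :: "'a pair_pre_digraph \<Rightarrow> ('a \<times> 'a) set \<Rightarrow> bool" where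
  "sparse_feedback_arc_set D F \<longleftrightarrow>
     feedback_arc_set D F \<and>
     (\<forall>v \<in> pverts D. ugraph_degree (fas_graph D F) v
        \<le> min (out_degree (with_proj D) v) (in_degree (with_proj D) v)) \<and>
     (\<forall>I. independent_set (fas_graph D F) I \<longrightarrow> acyclic_digraph (with_proj D \<restriction> I))"

text \<open>
  Machine model: structured programs for a random access machine. The memory consists of
  named arrays of natural numbers, finitely many of which occur in any one program; a scalar
  is cell 0 of its array. Arithmetic is limited to addition and truncated subtraction, and every
  operator, memory access, assignment and test is charged one step. Hence during \<open>t\<close> steps
  numbers grow by only O(t) bits, and this unit-cost model is polynomially equivalent to
  Turing machines. (Unit-cost multiplication would break this.)
\<close>

type_synonym vname = string
type_synonym store = "vname \<Rightarrow> nat \<Rightarrow> nat"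

datatype aexp = N nat | Rd vname aexp | Plus aexp aexp | Minus aexp aexp

datatype bexp = Less aexp aexp | Not bexp | And bexp bexp

datatype com =
    Skip
  | Assign vname aexp aexp  \<comment> \<open>array, index, value\<close>
  | Seq com com
  | Cond bexp com com
  | While bexp com

fun aval :: "aexp \<Rightarrow> store \<Rightarrow> nat" where
  "aval (N k) s = k"
| "aval (Rd x e) s = s x (aval e s)"
| "aval (Plus e f) s = aval e s + aval f s"
| "aval (Minus e f) s = aval e s - aval f s"

fun bval :: "bexp \<Rightarrow> store \<Rightarrow> bool" where
  "bval (Less e f) s \<longleftrightarrow> aval e s < aval f s"
| "bval (Not b) s \<longleftrightarrow> \<not> bval b s"
| "bval (And b c) s \<longleftrightarrow> bval b s \<and> bval c s"

fun acost :: "aexp \<Rightarrow> nat" where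
  "acost (N k) = 1"
| "acost (Rd x e) = 1 + acost e"
| "acost (Plus e f) = 1 + acost e + acost f"
| "acost (Minus e f) = 1 + acost e + acost f"

fun bcost :: "bexp \<Rightarrow> nat" where
  "bcost (Less e f) = 1 + acost e + acost f"
| "bcost (Not b) = 1 + bcost b"
| "bcost (And b c) = 1 + bcost b + bcost c"

text \<open>\<open>exec c s t s'\<close>: started in \<open>s\<close>, program \<open>c\<close> halts in \<open>s'\<close> after exactly \<open>t\<close> steps.\<close>

inductive exec :: "com \<Rightarrow> store \<Rightarrow> nat \<Rightarrow> store \<Rightarrow> bool" where
  Skip: "exec Skip s 1 s"
| Assign: "exec (Assign x i e) s (1 + acost i + acost e)
     (s(x := (s x)(aval i s := aval e s)))"
| Seq: "exec c s t s' \<Longrightarrow> exec d s' t' s'' \<Longrightarrow> exec (Seq c d) s (t + t') s''"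
| CondTrue: "bval b s \<Longrightarrow> exec c s t s' \<Longrightarrow> exec (Cond b c d) s (1 + bcost b + t) s'"
| CondFalse: "\<not> bval b s \<Longrightarrow> exec d s t s' \<Longrightarrow> exec (Cond b c d) s (1 + bcost b + t) s'"
| WhileFalse: "\<not> bval b s \<Longrightarrow> exec (While b c) s (1 + bcost b) s"
| WhileTrue: "bval b s \<Longrightarrow> exec c s t s' \<Longrightarrow> exec (While b c) s' t' s'' \<Longrightarrow>
     exec (While b c) s (1 + bcost b + t + t') s''"

inductive_cases SkipE: "exec Skip s t s'"
inductive_cases AssignE: "exec (Assign x i e) s t s'"
inductive_cases SeqE: "exec (Seq c d) s t s'"
inductive_cases CondE: "exec (Cond b c d) s t s'"
inductive_cases WhileE: "exec (While b c) s t s'"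

lemma exec_deterministic:
  "exec c s t s' \<Longrightarrow> exec c s u s'' \<Longrightarrow> u = t \<and> s'' = s'"
proof (induction arbitrary: u s'' rule: exec.induct)
  case (Skip s)
  then show ?case by (rule SkipE) simp
next
  case (Assign x i e s)
  then show ?case by (rule AssignE) simp
next
  case (Seq c s t s' d t' r)
  from Seq.prems show ?case by (rule SeqE) (auto dest: Seq.IH)
next
  case (CondTrue b s c t s' d)
  from CondTrue.prems show ?case by (rule CondE) (auto simp: CondTrue.hyps(1) dest: CondTrue.IH)
next
  case (CondFalse b s d t s' c)
  from CondFalse.prems show ?case by (rule CondE) (auto simp: CondFalse.hyps(1) dest: CondFalse.IH)
next
  case (WhileFalse b s c)
  from WhileFalse.prems show ?case by (rule WhileE) (use WhileFalse.hyps in simp_all)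
next
  case (WhileTrue b s c t s' t' r)
  from WhileTrue.prems show ?case by (rule WhileE) (auto simp: WhileTrue.hyps(1) dest: WhileTrue.IH)
qed

text \<open>
  Input encoding of a digraph with vertex set \<open>{0..<n}\<close>: the number of vertices,
  the number of arcs, and the list of arcs as two arrays; all other cells are 0. An arc set
  is output in the same form.
\<close>

definition input_store :: "nat \<Rightarrow> (nat \<times> nat) list \<Rightarrow> store" where
  "input_store n es = (\<lambda>x i.
     if x = ''n'' \<and> i = 0 then n
     else if x = ''m'' \<and> i = 0 then length es
     else if x = ''tail'' \<and> i < length es then fst (es ! i)
     else if x = ''head'' \<and> i < length es then snd (es ! i)
     else 0)"

definition output_arcs :: "store \<Rightarrow> (nat \<times> nat) list" where
  "output_arcs s = map (\<lambda>i. (s ''outtail'' i, s ''outhead'' i)) [0..<s ''outm'' 0]"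

definition digraph_size :: "'a pair_pre_digraph \<Rightarrow> nat" where
  "digraph_size D = card (pverts D) + card (parcs D)"

text \<open>
  A search problem \<open>R\<close> relates digraphs to admissible output arc sets. The program must
  work for every order in which the arcs of the input are listed.
\<close>

definition poly_time_solvable ::
    "(nat pair_pre_digraph \<Rightarrow> (nat \<times> nat) set \<Rightarrow> bool) \<Rightarrow> bool" where
  "poly_time_solvable R \<longleftrightarrow>
     (\<exists>(c :: com) (p :: nat poly). \<forall>D n es.
        pair_digraph D \<and> pverts D = {0..<n} \<and> distinct es \<and> set es = parcs D \<longrightarrow>
        (\<exists>t s. exec c (input_store n es) t s \<and> t \<le> poly p (digraph_size D) \<and>
               distinct (output_arcs s) \<and> R D (set (output_arcs s))))"

end

theory Submission
  imports Defs
begin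

text \<open>
  Start from the feedback arc set of all arcs and improve it locally. If more arcs of \<open>F\<close> meet
  a vertex \<open>v\<close> than there are arcs entering \<open>v\<close>, replace the arcs of \<open>F\<close> at \<open>v\<close> by all arcs entering
  \<open>v\<close>. Then \<open>v\<close> becomes a source of \<open>D - F\<close>, so \<open>D - F\<close> remains acyclic, and \<open>F\<close> gets smaller. The
  same works for the arcs leaving \<open>v\<close>. After at most \<open>|E(D)|\<close> exchanges (i) holds. Property (ii) holds
  for every feedback arc set: a cycle of \<open>D[I]\<close> contains an arc of \<open>F\<close>, which is an edge of
  \<open>G(D,F)\<close> inside \<open>I\<close>.
\<close>

section \<open>Local improvement of feedback arc sets\<close>

lemma cas_imp_trancl:
  assumes "pre_digraph.cas G u p v" "set p \<subseteq> arcs G" "p \<noteq> []"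
  shows "(u, v) \<in> ((\<lambda>e. (tail G e, head G e)) ` arcs G)\<^sup>+"
  using assms
proof (induction p arbitrary: u)
  case (Cons e p)
  have e: "(u, head G e) \<in> (\<lambda>e. (tail G e, head G e)) ` arcs G"
    using Cons.prems by (auto simp: pre_digraph.cas.simps)
  show ?case
  proof (cases "p = []")
    case True
    then show ?thesis using Cons.prems e by (auto simp: pre_digraph.cas.simps)
  next
    case False
    then have "(head G e, v) \<in> ((\<lambda>e. (tail G e, head G e)) ` arcs G)\<^sup>+"
      using Cons.prems by (intro Cons.IH) (auto simp: pre_digraph.cas.simps)
    with e show ?thesis by (rule trancl_into_trancl2)
  qed
qed simp

text \<open>A cycle of the library is a nonempty closed walk and so puts a pair (u, u) into the
  transitive closure of the arc relation. Acyclicity can thus be handled for plain relations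
  below.\<close>

lemma acyclic_digraphI:
  assumes "acyclic ((\<lambda>e. (tail G e, head G e)) ` arcs G)"
  shows "acyclic_digraph G"
  unfolding acyclic_digraph_def pre_digraph.cycle_def pre_digraph.awalk_def
  using assms cas_imp_trancl unfolding acyclic_def by metis

text \<open>Both arcs of an opposite pair are counted, so the cardinality may exceed the degree in
  \<open>fas_graph\<close>. Counting arcs suits the exchange, since deleting these arcs shrinks a
  finite \<open>F\<close> by exactly this number.\<close>

definition arcs_at :: "('a \<times> 'a) set \<Rightarrow> 'a \<Rightarrow> ('a \<times> 'a) set" where
  "arcs_at F v = {e \<in> F. fst e = v \<or> snd e = v}"

text \<open>Common interface for the existence proof and the program. The edges of
  \<open>fas_graph D F\<close> at \<open>v\<close> are images of the arcs in
  \<open>arcs_at F v\<close> with orientation forgotten, so bounds on arc counts carry over to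
  degrees.\<close>

lemma sparse_feedback_arc_setI:
  assumes "pair_digraph D" and F: "F \<subseteq> parcs D" and acyc: "acyclic (parcs D - F)"
    and indeg: "\<And>v. v \<in> pverts D \<Longrightarrow> card (arcs_at F v) \<le> card {e \<in> parcs D. snd e = v}"
    and outdeg: "\<And>v. v \<in> pverts D \<Longrightarrow> card (arcs_at F v) \<le> card {e \<in> parcs D. fst e = v}"
  shows "sparse_feedback_arc_set D F"
proof -
  interpret pair_digraph D by fact
  have "feedback_arc_set D F"
    unfolding feedback_arc_set_def using F acyc by (auto intro!: acyclic_digraphI)
  moreover have "ugraph_degree (fas_graph D F) v \<le> card (arcs_at F v)" for v
  proof -
    have "finite (arcs_at F v)"
      by (rule finite_subset[OF _ finite_subset[OF F pair_finite_arcs]]) (auto simp: arcs_at_def)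
    moreover have "{e \<in> snd (fas_graph D F). v \<in> e} \<subseteq> (\<lambda>(a, b). {a, b}) ` arcs_at F v"
      by (force simp: fas_graph_def arcs_at_def)
    ultimately show ?thesis
      unfolding ugraph_degree_def by (rule surj_card_le)
  qed
  moreover have "acyclic_digraph (with_proj D \<restriction> I)" if "independent_set (fas_graph D F) I" for I
  proof (rule acyclic_digraphI)
    have "(\<lambda>e. (tail (with_proj D \<restriction> I) e, head (with_proj D \<restriction> I) e)) ` arcs (with_proj D \<restriction> I)
        \<subseteq> parcs D - F"
      using that by (fastforce simp: independent_set_def fas_graph_def)
    then show "acyclic ((\<lambda>e. (tail (with_proj D \<restriction> I) e, head (with_proj D \<restriction> I) e)) `
        arcs (with_proj D \<restriction> I))"
      by (rule acyclic_subset[OF acyc])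
  qed
  ultimately show ?thesis
    unfolding sparse_feedback_arc_set_def in_degree_def out_degree_def in_arcs_def out_arcs_def
    by (auto intro: order.trans[OF _ indeg] order.trans[OF _ outdeg])
qed

text \<open>Nothing enters \<open>v\<close> in \<open>s\<close>, so a walk can visit
  \<open>v\<close> only at its start. A walk starting elsewhere runs inside \<open>r\<close>, and a
  closed walk at \<open>v\<close> would have to enter \<open>v\<close>.\<close>

lemma acyclic_new_source:
  assumes "acyclic r" "v \<notin> Range s" "\<And>x y. (x, y) \<in> s \<Longrightarrow> x \<noteq> v \<Longrightarrow> (x, y) \<in> r"
  shows "acyclic s"
proof -
  have "x \<noteq> v \<longrightarrow> (x, y) \<in> r\<^sup>+" if "(x, y) \<in> s\<^sup>+" for x y
    using that
  proof induction
    case (base y)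
    then show ?case using assms(3) by auto
  next
    case (step y z)
    moreover have "y \<noteq> v" using step(1) assms(2) by (metis Range_iff tranclE)
    ultimately show ?case using assms(3) by (metis trancl.trancl_into_trancl)
  qed
  moreover have "(v, v) \<notin> s\<^sup>+" using assms(2) by (metis Range_iff tranclE)
  ultimately show ?thesis using assms(1) unfolding acyclic_def by metis
qed

definition exchange_in :: "('a \<times> 'a) set \<Rightarrow> ('a \<times> 'a) set \<Rightarrow> 'a \<Rightarrow> ('a \<times> 'a) set" where
  "exchange_in A F v = (F - arcs_at F v) \<union> {e \<in> A. snd e = v}"

definition exchange_out :: "('a \<times> 'a) set \<Rightarrow> ('a \<times> 'a) set \<Rightarrow> 'a \<Rightarrow> ('a \<times> 'a) set" where
  "exchange_out A F v = (F - arcs_at F v) \<union> {e \<in> A. fst e = v}"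

lemma acyclic_exchange_in:
  assumes "acyclic (A - F)"
  shows "acyclic (A - exchange_in A F v)"
  by (rule acyclic_new_source[OF assms, of v]) (auto simp: exchange_in_def arcs_at_def)

lemma acyclic_exchange_out:
  assumes "acyclic (A - F)"
  shows "acyclic (A - exchange_out A F v)"
proof -
  \<comment> \<open>The exchange makes \<open>v\<close> a sink, which is a source of the converse
    relation.\<close>
  have "acyclic ((A - exchange_out A F v)\<inverse>)"
    by (rule acyclic_new_source[of "(A - F)\<inverse>" v])
      (use assms in \<open>auto simp: exchange_out_def arcs_at_def\<close>)
  then show ?thesis by simp
qed

lemma card_exchange_less:
  assumes "finite F" "card S < card (arcs_at F v)"
  shows "card ((F - arcs_at F v) \<union> S) < card F"
proof -
  have "arcs_at F v \<subseteq> F" by (auto simp: arcs_at_def)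
  then have "card (F - arcs_at F v) = card F - card (arcs_at F v)" "card (arcs_at F v) \<le> card F"
    using assms(1) by (auto intro: card_Diff_subset finite_subset card_mono)
  then show ?thesis using card_Un_le[of "F - arcs_at F v" S] assms(2) by linarith
qed

text \<open>The iteration is replaced by an extremal choice: a smallest set satisfying
  \<open>P\<close> admits no improving exchange. This covers every vertex type, whereas the program
  works on natural numbers.\<close>

lemma ex_sparse_feedback_arc_set:
  assumes "pair_digraph D"
  shows "\<exists>F. sparse_feedback_arc_set D F"
proof -
  interpret pair_digraph D by fact
  define P where "P F \<longleftrightarrow> F \<subseteq> parcs D \<and> acyclic (parcs D - F)" for F
  have "P (parcs D)" by (simp add: P_def acyclic_def)
  then obtain F where F: "P F" and min: "\<And>F'. P F' \<Longrightarrow> card F \<le> card F'"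
    using ex_has_least_nat[of P "parcs D" card] by blast
  have fin: "finite F" using F pair_finite_arcs by (auto simp: P_def intro: finite_subset)
  have "P (exchange_in (parcs D) F v)" "P (exchange_out (parcs D) F v)" for v
    using F acyclic_exchange_in[of "parcs D" F] acyclic_exchange_out[of "parcs D" F]
    by (auto simp: P_def exchange_in_def exchange_out_def)
  \<comment> \<open>If a bound failed at \<open>v\<close>, the corresponding exchange would give a
    smaller set satisfying \<open>P\<close>.\<close>
  then have "card (arcs_at F v) \<le> card {e \<in> parcs D. snd e = v}"
    "card (arcs_at F v) \<le> card {e \<in> parcs D. fst e = v}" for v
    using min card_exchange_less[OF fin] unfolding exchange_in_def exchange_out_def
    by (meson not_le)+
  then show ?thesis
    using F sparse_feedback_arc_setI[OF assms] unfolding P_def by blast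
qed

section \<open>Total correctness with step bounds\<close>

text \<open>One halting run within \<open>T\<close> steps amounts to total correctness because
  \<open>exec\<close> is deterministic.\<close>

definition runs :: "com \<Rightarrow> store \<Rightarrow> nat \<Rightarrow> (store \<Rightarrow> bool) \<Rightarrow> bool" where
  "runs c s T Q \<longleftrightarrow> (\<exists>t s'. exec c s t s' \<and> t \<le> T \<and> Q s')"

lemma runs_mono: "runs c s T Q \<Longrightarrow> T \<le> T' \<Longrightarrow> (\<And>s'. Q s' \<Longrightarrow> Q' s') \<Longrightarrow> runs c s T' Q'"
  unfolding runs_def by (meson order.trans)

lemma runs_Skip: "1 \<le> T \<Longrightarrow> Q s \<Longrightarrow> runs Skip s T Q"
  unfolding runs_def using exec.Skip by blast

lemma runs_Assign:
  "1 + acost i + acost e \<le> T \<Longrightarrow> Q (s(x := (s x)(aval i s := aval e s))) \<Longrightarrow>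
    runs (Assign x i e) s T Q"
  unfolding runs_def using exec.Assign by blast

lemma runs_Seq:
  assumes "runs c s Tc P" "\<And>s'. P s' \<Longrightarrow> runs d s' Td Q" "Tc + Td \<le> T"
  shows "runs (Seq c d) s T Q"
  using assms unfolding runs_def by (meson exec.Seq add_mono order.trans)

lemma runs_Cond:
  assumes "bval b s \<Longrightarrow> runs c s T' Q" "\<not> bval b s \<Longrightarrow> runs d s T' Q" "1 + bcost b + T' \<le> T"
  shows "runs (Cond b c d) s T Q"
  using assms unfolding runs_def
  by (cases "bval b s") (meson exec.CondTrue exec.CondFalse add_left_mono order.trans)+

text \<open>There are at most \<open>\<mu> s\<close> iterations, each costing one test and at most
  \<open>T\<close> steps. The summand 1 pays for the final failing test, generously charged as a
  full round.\<close>

lemma runs_While: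
  fixes \<mu> :: "store \<Rightarrow> nat"
  assumes "\<And>s. I s \<Longrightarrow> bval b s \<Longrightarrow> runs c s T (\<lambda>s'. I s' \<and> \<mu> s' < \<mu> s)" "I s"
  shows "runs (While b c) s ((\<mu> s + 1) * (1 + bcost b + T)) (\<lambda>s'. I s' \<and> \<not> bval b s')"
  using assms(2)
proof (induction "\<mu> s" arbitrary: s rule: less_induct)
  case less
  show ?case
  proof (cases "bval b s")
    case False
    then show ?thesis unfolding runs_def using exec.WhileFalse less.prems by fastforce
  next
    case True
    then obtain t s' where c: "exec c s t s'" "t \<le> T" "I s'" "\<mu> s' < \<mu> s"
      using assms(1) less.prems unfolding runs_def by blast
    with less.hyps obtain t' s'' where w: "exec (While b c) s' t' s''"
      "t' \<le> (\<mu> s' + 1) * (1 + bcost b + T)" "I s''" "\<not> bval b s''"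
      unfolding runs_def by blast
    have "(\<mu> s' + 1) * (1 + bcost b + T) \<le> \<mu> s * (1 + bcost b + T)"
      using c(4) by (intro mult_right_mono) auto
    then have "1 + bcost b + t + t' \<le> (\<mu> s + 1) * (1 + bcost b + T)"
      using c(2) w(2) by simp
    then show ?thesis
      unfolding runs_def using exec.WhileTrue[OF True c(1) w(1)] w by blast
  qed
qed

abbreviation Var :: "vname \<Rightarrow> aexp" where
  "Var x \<equiv> Rd x (N 0)"

abbreviation Set_var :: "vname \<Rightarrow> aexp \<Rightarrow> com" where
  "Set_var x e \<equiv> Assign x (N 0) e"

abbreviation Incr :: "vname \<Rightarrow> com" where
  "Incr x \<equiv> Set_var x (Plus (Var x) (N 1))"

abbreviation Eq :: "aexp \<Rightarrow> aexp \<Rightarrow> bexp" where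
  "Eq e f \<equiv> And (Not (Less e f)) (Not (Less f e))"

abbreviation Or :: "bexp \<Rightarrow> bexp \<Rightarrow> bexp" where
  "Or b c \<equiv> Not (And (Not b) (Not c))"

definition for_arcs :: "com \<Rightarrow> com" where
  "for_arcs c = Seq (Set_var ''i'' (N 0))
     (While (Less (Var ''i'') (Var ''m'')) (Seq c (Incr ''i'')))"

text \<open>\<open>P k\<close> describes the store when the counter is \<open>k\<close>, so the body
  must establish \<open>P (Suc j)\<close> for the store after the increment that follows it. The 3
  pays for the initial assignment and the 12 for one test and one increment, 6 each.\<close>

lemma runs_for_arcs:
  assumes "s ''m'' 0 = m" "P 0 (s(''i'' := (s ''i'')(0 := 0)))"
    and body: "\<And>j s. j < m \<Longrightarrow> s ''i'' 0 = j \<Longrightarrow> s ''m'' 0 = m \<Longrightarrow> P j s \<Longrightarrow>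
      runs c s B (\<lambda>s'. s' ''i'' 0 = j \<and> s' ''m'' 0 = m \<and>
        P (Suc j) (s'(''i'' := (s' ''i'')(0 := Suc j))))"
  shows "runs (for_arcs c) s (3 + (m + 1) * (B + 12)) (P m)"
proof -
  define I where "I s \<longleftrightarrow> s ''m'' 0 = m \<and> s ''i'' 0 \<le> m \<and> P (s ''i'' 0) s" for s :: store
  let ?b = "Less (Var ''i'') (Var ''m'')"
  let ?s = "s(''i'' := (s ''i'')(0 := 0))"
  have "runs (Seq c (Incr ''i'')) s (B + 6) (\<lambda>s'. I s' \<and> m - s' ''i'' 0 < m - s ''i'' 0)"
    if "I s" "bval ?b s" for s
    by (rule runs_Seq[OF body[of "s ''i'' 0" s], where Td = 6])
      (use that in \<open>auto simp: I_def intro!: runs_Assign\<close>)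
  moreover have "I ?s" using assms by (simp add: I_def)
  ultimately have
    "runs (While ?b (Seq c (Incr ''i''))) ?s
      ((m - ?s ''i'' 0 + 1) * (1 + bcost ?b + (B + 6))) (\<lambda>s'. I s' \<and> \<not> bval ?b s')"
    by (rule runs_While[where I = I and \<mu> = "\<lambda>s. m - s ''i'' 0"])
  then have "runs (While ?b (Seq c (Incr ''i''))) ?s ((m + 1) * (B + 12)) (P m)"
    by (rule runs_mono) (auto simp: I_def)
  then show ?thesis
    unfolding for_arcs_def
    by (intro runs_Seq[where Tc = 3 and P = "\<lambda>s'. s' = ?s"] runs_Assign) auto
qed

section \<open>The local search program\<close>

definition count_arcs :: "vname \<Rightarrow> bexp \<Rightarrow> com" where
  "count_arcs x b = Seq (Set_var x (N 0)) (for_arcs (Cond b (Incr x) Skip))"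

lemma card_less_Suc:
  "card {j. j < Suc k \<and> Q j} = (if Q k then Suc (card {j. j < k \<and> Q j}) else card {j. j < k \<and> Q j})"
proof -
  have "{j. j < Suc k \<and> Q j} = (if Q k then insert k {j. j < k \<and> Q j} else {j. j < k \<and> Q j})"
    by (auto simp: less_Suc_eq)
  then show ?thesis by simp
qed

text \<open>Only \<open>x\<close> and the counter change during the loop, so the test has to be
  understood just in stores agreeing with \<open>s\<close> elsewhere. The cap 50 accommodates the
  costliest test used below, which costs 48.\<close>

lemma runs_count_arcs:
  assumes m: "s ''m'' 0 = m" and x: "x \<noteq> ''i''" "x \<noteq> ''m''"
    and b: "\<And>s' j. (\<And>y. y \<noteq> x \<Longrightarrow> y \<noteq> ''i'' \<Longrightarrow> s' y = s y) \<Longrightarrow> j < m \<Longrightarrow> s' ''i'' 0 = j \<Longrightarrow>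
      bval b s' \<longleftrightarrow> Q j"
    and cost: "bcost b \<le> 50"
  shows "runs (count_arcs x b) s (80 * (m + 1))
    (\<lambda>s'. s' x 0 = card {j. j < m \<and> Q j} \<and> (\<forall>y. y \<noteq> x \<longrightarrow> y \<noteq> ''i'' \<longrightarrow> s' y = s y))"
proof -
  define P where "P k s' \<longleftrightarrow> s' x 0 = card {j. j < k \<and> Q j} \<and>
    (\<forall>y. y \<noteq> x \<longrightarrow> y \<noteq> ''i'' \<longrightarrow> s' y = s y)" for k and s' :: store
  \<comment> \<open>The body bound 57 is 1 for branching, 50 for the test and 6 for the
    increment.\<close>
  have "runs (for_arcs (Cond b (Incr x) Skip)) (s(x := (s x)(0 := 0))) (3 + (m + 1) * (57 + 12)) (P m)"
  proof (rule runs_for_arcs)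
    fix j s' assume *: "j < m" "s' ''i'' 0 = j" "s' ''m'' 0 = m" "P j s'"
    then have "bval b s' \<longleftrightarrow> Q j" by (intro b) (auto simp: P_def)
    with * show "runs (Cond b (Incr x) Skip) s' 57 (\<lambda>s'. s' ''i'' 0 = j \<and> s' ''m'' 0 = m \<and>
        P (Suc j) (s'(''i'' := (s' ''i'')(0 := Suc j))))"
      using x cost
      by (intro runs_Cond[where T' = 6] runs_Assign runs_Skip) (auto simp: P_def card_less_Suc)
  qed (use m x in \<open>auto simp: P_def\<close>)
  then show ?thesis
    unfolding count_arcs_def P_def
    by (intro runs_Seq[where Tc = 3 and P = "\<lambda>s'. s' = s(x := (s x)(0 := 0))"] runs_Assign) auto
qed

text \<open>
  Arc \<open>i\<close> belongs to \<open>F\<close> iff \<open>keep[i] = 0\<close>, so that the initial store represents the set of all arcs.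
\<close>

definition exchange_arcs :: "vname \<Rightarrow> vname \<Rightarrow> com" where
  "exchange_arcs x y = for_arcs (Cond (Eq (Rd x (Var ''i'')) (Var ''v''))
     (Assign ''keep'' (Var ''i'') (N 0))
     (Cond (Eq (Rd y (Var ''i'')) (Var ''v'')) (Assign ''keep'' (Var ''i'') (N 1)) Skip))"

text \<open>With \<open>x\<close> the heads and \<open>y\<close> the tails this performs
  \<open>exchange_in\<close> at the current vertex; with the roles swapped it performs
  \<open>exchange_out\<close>.\<close>

lemma runs_exchange_arcs:
  assumes m: "s ''m'' 0 = m" and xy: "x \<notin> {''i'', ''keep''}" "y \<notin> {''i'', ''keep''}"
  shows "runs (exchange_arcs x y) s (80 * (m + 1))
    (\<lambda>s'. (\<forall>j < m. s' ''keep'' j = (if s x j = s ''v'' 0 then 0 else if s y j = s ''v'' 0 then 1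
        else s ''keep'' j)) \<and> (\<forall>z. z \<noteq> ''keep'' \<longrightarrow> z \<noteq> ''i'' \<longrightarrow> s' z = s z))"
proof -
  define new where "new j = (if s x j = s ''v'' 0 then 0 else if s y j = s ''v'' 0 then 1
    else s ''keep'' j)" for j
  define P where "P k s' \<longleftrightarrow> s' ''keep'' = (\<lambda>j. if j < k then new j else s ''keep'' j) \<and>
    (\<forall>z. z \<noteq> ''keep'' \<longrightarrow> z \<noteq> ''i'' \<longrightarrow> s' z = s z)" for k and s' :: store
  have "runs (exchange_arcs x y) s (3 + (m + 1) * (40 + 12)) (P m)"
    unfolding exchange_arcs_def
  proof (rule runs_for_arcs)
    fix j s' assume *: "j < m" "s' ''i'' 0 = j" "s' ''m'' 0 = m" "P j s'"
    then have eq: "s' x = s x" "s' y = s y" "s' ''v'' = s ''v''" using xy by (auto simp: P_def)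
    have upd: "P (Suc j) (s'(''keep'' := (s' ''keep'')(j := new j), ''i'' := f))" for f
      using *(4) by (auto simp: P_def fun_eq_iff less_Suc_eq)
    have keep: "s' ''keep'' j = s ''keep'' j" using *(4) by (simp add: P_def)
    \<comment> \<open>Leaving a cell alone is the same as writing its old value into it.\<close>
    have skip: "P (Suc j) (s'(''i'' := f))" if "new j = s ''keep'' j" for f
      using upd[of f] that keep by (metis fun_upd_triv)
    show "runs (Cond (Eq (Rd x (Var ''i'')) (Var ''v''))
       (Assign ''keep'' (Var ''i'') (N 0))
       (Cond (Eq (Rd y (Var ''i'')) (Var ''v'')) (Assign ''keep'' (Var ''i'') (N 1)) Skip))
       s' 40 (\<lambda>s'. s' ''i'' 0 = j \<and> s' ''m'' 0 = m \<and>
        P (Suc j) (s'(''i'' := (s' ''i'')(0 := Suc j))))"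
    proof (rule runs_Cond[where T' = 23], goal_cases)
      case 1
      then show ?case using * eq upd by (intro runs_Assign) (auto simp: new_def)
    next
      case 2
      then have ne: "s x j \<noteq> s ''v'' 0" using * eq by auto
      show ?case
      proof (rule runs_Cond[where T' = 5], goal_cases)
        case 1
        then show ?case using * eq upd ne by (intro runs_Assign) (auto simp: new_def)
      next
        case 2
        then show ?case using * eq skip ne by (intro runs_Skip) (auto simp: new_def)
      qed simp
    qed simp
  qed (use m in \<open>auto simp: P_def\<close>)
  then show ?thesis by (rule runs_mono) (auto simp: P_def new_def)
qed

text \<open>After an exchange the scan returns to vertex 0, since the arcs added at \<open>v\<close>
  may raise the count at vertices that were already checked.\<close>

definition improve :: com where
  "improve =
     Seq (count_arcs ''deg'' (And (Eq (Rd ''keep'' (Var ''i'')) (N 0))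
       (Or (Eq (Rd ''tail'' (Var ''i'')) (Var ''v'')) (Eq (Rd ''head'' (Var ''i'')) (Var ''v'')))))
    (Seq (count_arcs ''indeg'' (Eq (Rd ''head'' (Var ''i'')) (Var ''v'')))
    (Seq (count_arcs ''outdeg'' (Eq (Rd ''tail'' (Var ''i'')) (Var ''v'')))
    (Cond (Less (Var ''indeg'') (Var ''deg''))
       (Seq (exchange_arcs ''head'' ''tail'') (Set_var ''v'' (N 0)))
    (Cond (Less (Var ''outdeg'') (Var ''deg''))
       (Seq (exchange_arcs ''tail'' ''head'') (Set_var ''v'' (N 0)))
       (Incr ''v'')))))"

definition emit :: com where
  "emit = for_arcs (Cond (Eq (Rd ''keep'' (Var ''i'')) (N 0))
     (Seq (Assign ''outtail'' (Var ''outm'') (Rd ''tail'' (Var ''i'')))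
     (Seq (Assign ''outhead'' (Var ''outm'') (Rd ''head'' (Var ''i'')))
     (Incr ''outm''))) Skip)"

text \<open>The search relies on \<open>v\<close> and \<open>keep\<close> being 0 in
  \<open>input_store\<close>: it starts at vertex 0 with all arcs in \<open>F\<close>.\<close>

definition local_search :: com where
  "local_search = Seq (While (Less (Var ''v'') (Var ''n'')) improve)
     (Seq (Set_var ''outm'' (N 0)) emit)"

section \<open>Arc sets represented by flags on list positions\<close>

definition selected :: "'a list \<Rightarrow> (nat \<Rightarrow> nat) \<Rightarrow> 'a set" where
  "selected es k = (!) es ` {j. j < length es \<and> k j = 0}"

lemma selected_subset: "selected es k \<subseteq> set es"
  by (auto simp: selected_def)

lemma nth_in_selected:
  "distinct es \<Longrightarrow> j < length es \<Longrightarrow> es ! j \<in> selected es k \<longleftrightarrow> k j = 0"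
  by (auto simp: selected_def nth_eq_iff_index_eq)

text \<open>Distinctness makes indexing injective, so the counters of the program, which count
  positions, give cardinalities of arc sets.\<close>

lemma card_Collect_nth:
  assumes "distinct es" "A \<subseteq> set es"
  shows "card A = card {j. j < length es \<and> es ! j \<in> A}"
proof -
  have "A = (!) es ` {j. j < length es \<and> es ! j \<in> A}"
    using assms(2) by (force simp: in_set_conv_nth)
  moreover have "inj_on ((!) es) {j. j < length es \<and> es ! j \<in> A}"
    by (rule inj_on_nth) (use assms(1) in auto)
  ultimately show ?thesis by (metis card_image)
qed

text \<open>The order of the tests mirrors the definition: an arc entering \<open>v\<close> is
  selected whatever its old flag, any other arc at \<open>v\<close> is dropped, and the remaining
  arcs keep their status.\<close>

lemma selected_exchange_in:
  assumes "distinct es" "\<And>j. j < length es \<Longrightarrow>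
    k' j = (if snd (es ! j) = v then 0 else if fst (es ! j) = v then 1 else k j)"
  shows "selected es k' = exchange_in (set es) (selected es k) v"
proof (rule set_eqI)
  fix e
  show "e \<in> selected es k' \<longleftrightarrow> e \<in> exchange_in (set es) (selected es k) v"
  proof (cases "e \<in> set es")
    case True
    then obtain j where "j < length es" "e = es ! j" by (auto simp: in_set_conv_nth)
    then show ?thesis
      using assms by (auto simp: exchange_in_def arcs_at_def nth_in_selected)
  qed (auto simp: exchange_in_def selected_def)
qed

lemma selected_exchange_out:
  assumes "distinct es" "\<And>j. j < length es \<Longrightarrow>
    k' j = (if fst (es ! j) = v then 0 else if snd (es ! j) = v then 1 else k j)"
  shows "selected es k' = exchange_out (set es) (selected es k) v"
proof (rule set_eqI)
  fix e
  show "e \<in> selected es k' \<longleftrightarrow> e \<in> exchange_out (set es) (selected es k) v"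
  proof (cases "e \<in> set es")
    case True
    then obtain j where "j < length es" "e = es ! j" by (auto simp: in_set_conv_nth)
    then show ?thesis
      using assms by (auto simp: exchange_out_def arcs_at_def nth_in_selected)
  qed (auto simp: exchange_out_def selected_def)
qed

section \<open>Invariant and termination of the local search\<close>

definition encodes :: "nat \<Rightarrow> (nat \<times> nat) list \<Rightarrow> store \<Rightarrow> bool" where
  "encodes n es s \<longleftrightarrow> s ''n'' 0 = n \<and> s ''m'' 0 = length es \<and>
     (\<forall>j < length es. s ''tail'' j = fst (es ! j) \<and> s ''head'' j = snd (es ! j))"

definition locally_sparse :: "('a \<times> 'a) set \<Rightarrow> ('a \<times> 'a) set \<Rightarrow> 'a \<Rightarrow> bool" where
  "locally_sparse A F v \<longleftrightarrow> card (arcs_at F v) \<le> card {e \<in> A. snd e = v} \<and>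
     card (arcs_at F v) \<le> card {e \<in> A. fst e = v}"

text \<open>Vertices below the current one have passed both tests for the current \<open>F\<close>.
  The bound by \<open>n\<close> forces the current vertex to equal \<open>n\<close> when the loop
  ends, so that all vertices have passed.\<close>

definition search_inv :: "nat \<Rightarrow> (nat \<times> nat) list \<Rightarrow> store \<Rightarrow> bool" where
  "search_inv n es s \<longleftrightarrow> encodes n es s \<and> acyclic (set es - selected es (s ''keep'')) \<and>
     s ''v'' 0 \<le> n \<and> (\<forall>u < s ''v'' 0. locally_sparse (set es) (selected es (s ''keep'')) u)"

text \<open>This encodes the lexicographic order on the size of \<open>F\<close> and the distance of
  the scan from its end. The second summand is at most \<open>n\<close>, so losing one arc outweighs
  a restart.\<close>

definition search_measure :: "nat \<Rightarrow> (nat \<times> nat) list \<Rightarrow> store \<Rightarrow> nat" where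
  "search_measure n es s = card (selected es (s ''keep'')) * (n + 1) + (n - s ''v'' 0)"

lemma search_measure_less:
  assumes "card (selected es (s' ''keep'')) < card (selected es (s ''keep''))"
  shows "search_measure n es s' < search_measure n es s"
proof -
  have "Suc (card (selected es (s' ''keep''))) * (n + 1) \<le> card (selected es (s ''keep'')) * (n + 1)"
    using assms by (intro mult_right_mono) auto
  then show ?thesis unfolding search_measure_def by simp
qed

text \<open>Either an exchange shrinks \<open>F\<close> and the scan restarts, or \<open>v\<close>
  passes both tests and the scan advances. Both lower the measure.\<close>

lemma runs_improve:
  assumes dist: "distinct es" and inv: "search_inv n es s" and less: "s ''v'' 0 < n"
  shows "runs improve s (400 * (length es + 1))
    (\<lambda>s'. search_inv n es s' \<and> search_measure n es s' < search_measure n es s)"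
proof -
  define m where "m = length es"
  define A where "A = set es"
  define v where "v = s ''v'' 0"
  define F where "F = selected es (s ''keep'')"
  define d where "d = card (arcs_at F v)"
  define a where "a = card {e \<in> A. snd e = v}"
  define b where "b = card {e \<in> A. fst e = v}"
  have enc: "s ''n'' 0 = n" "s ''m'' 0 = m" "\<And>j. j < m \<Longrightarrow> s ''tail'' j = fst (es ! j)"
    "\<And>j. j < m \<Longrightarrow> s ''head'' j = snd (es ! j)" and encs: "encodes n es s"
    using inv by (auto simp: search_inv_def encodes_def m_def)
  have acyc: "acyclic (A - F)" and sparse: "\<And>u. u < v \<Longrightarrow> locally_sparse A F u"
    using inv by (auto simp: search_inv_def A_def F_def v_def)
  have fin: "finite F" using selected_subset[of es] by (auto simp: F_def intro: finite_subset)

  have d: "d = card {j. j < m \<and> s ''keep'' j = 0 \<and> (fst (es ! j) = v \<or> snd (es ! j) = v)}"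
  proof -
    have "{j. j < m \<and> es ! j \<in> arcs_at F v} =
        {j. j < m \<and> s ''keep'' j = 0 \<and> (fst (es ! j) = v \<or> snd (es ! j) = v)}"
      by (auto simp: arcs_at_def F_def m_def nth_in_selected[OF dist])
    moreover have "arcs_at F v \<subseteq> set es"
      using selected_subset[of es] by (auto simp: arcs_at_def F_def)
    ultimately show ?thesis
      using card_Collect_nth[OF dist] unfolding d_def m_def by metis
  qed
  have a: "a = card {j. j < m \<and> snd (es ! j) = v}"
    using card_Collect_nth[OF dist, of "{e \<in> A. snd e = v}"]
    unfolding a_def m_def A_def by (auto intro!: arg_cong[of _ _ card])
  have b: "b = card {j. j < m \<and> fst (es ! j) = v}"
    using card_Collect_nth[OF dist, of "{e \<in> A. fst e = v}"]
    unfolding b_def m_def A_def by (auto intro!: arg_cong[of _ _ card])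

  \<comment> \<open>The counting loops affect only their results and the loop counter, hence neither
    \<open>F\<close> nor the current vertex.\<close>
  define same where "same s' \<longleftrightarrow>
    (\<forall>x. x \<notin> {''deg'', ''indeg'', ''outdeg'', ''i''} \<longrightarrow> s' x = s x)" for s' :: store
  define Q where "Q s' \<longleftrightarrow> search_inv n es s' \<and> search_measure n es s' < search_measure n es s"
    for s'

  \<comment> \<open>Both exchanges are treated at once. The hypothesis \<open>sel\<close> ranges
    over all flag arrays with the right values below \<open>m\<close>, since only these cells are
    known after the loop.\<close>
  have exchange_case: "runs (Seq (exchange_arcs x y) (Set_var ''v'' (N 0))) s' (80 * (m + 1) + 3) Q"
    if s': "same s'" and xy: "x \<in> {''head'', ''tail''}" "y \<in> {''head'', ''tail''}"
      and sel: "\<And>k'. (\<And>j. j < m \<Longrightarrow> k' j = (if s x j = v then 0 else if s y j = v then 1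
          else s ''keep'' j)) \<Longrightarrow> acyclic (A - selected es k') \<and> card (selected es k') < card F"
    for s' x y
  proof (rule runs_Seq[where Td = 3])
    show "runs (exchange_arcs x y) s' (80 * (m + 1)) (\<lambda>s''. (\<forall>j < m. s'' ''keep'' j =
        (if s' x j = s' ''v'' 0 then 0 else if s' y j = s' ''v'' 0 then 1 else s' ''keep'' j)) \<and>
        (\<forall>z. z \<noteq> ''keep'' \<longrightarrow> z \<noteq> ''i'' \<longrightarrow> s'' z = s' z))"
    proof (rule runs_exchange_arcs)
      show "s' ''m'' 0 = m" using s' enc(2) by (simp add: same_def)
    qed (use xy in auto)
  next
    fix s'' :: store
    assume s'': "(\<forall>j < m. s'' ''keep'' j =
        (if s' x j = s' ''v'' 0 then 0 else if s' y j = s' ''v'' 0 then 1 else s' ''keep'' j)) \<and>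
        (\<forall>z. z \<noteq> ''keep'' \<longrightarrow> z \<noteq> ''i'' \<longrightarrow> s'' z = s' z)"
    let ?t = "s''(''v'' := (s'' ''v'')(0 := 0))"
    have "x \<notin> {''deg'', ''indeg'', ''outdeg'', ''i''}" "y \<notin> {''deg'', ''indeg'', ''outdeg'', ''i''}"
      using xy by auto
    with s' have "s' x = s x" "s' y = s y" unfolding same_def by blast+
    moreover have "s' ''v'' 0 = v" "s' ''keep'' = s ''keep''"
      using s' by (simp_all add: same_def v_def)
    ultimately have k: "acyclic (A - selected es (s'' ''keep''))" "card (selected es (s'' ''keep'')) < card F"
      using sel[of "s'' ''keep''"] s'' by auto
    have "encodes n es ?t"
      using encs s' s'' by (simp add: encodes_def same_def)
    then have "search_inv n es ?t" using k by (simp add: search_inv_def A_def)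
    moreover have "search_measure n es ?t < search_measure n es s"
      using k by (intro search_measure_less) (simp add: F_def)
    ultimately show "runs (Set_var ''v'' (N 0)) s'' 3 Q"
      by (intro runs_Assign) (auto simp: Q_def)
  qed simp

  have in_case: "runs (Seq (exchange_arcs ''head'' ''tail'') (Set_var ''v'' (N 0))) s'
      (80 * (m + 1) + 3) Q" if "same s'" "a < d" for s'
  proof (rule exchange_case[OF that(1)])
    fix k' :: "nat \<Rightarrow> nat"
    assume "\<And>j. j < m \<Longrightarrow> k' j = (if s ''head'' j = v then 0 else if s ''tail'' j = v then 1
          else s ''keep'' j)"
    then have "selected es k' = exchange_in A F v"
      unfolding A_def F_def by (intro selected_exchange_in dist) (auto simp: enc m_def[symmetric])
    then show "acyclic (A - selected es k') \<and> card (selected es k') < card F"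
      using acyclic_exchange_in[OF acyc] card_exchange_less[OF fin] that(2)
      by (simp add: exchange_in_def a_def d_def)
  qed auto

  have out_case: "runs (Seq (exchange_arcs ''tail'' ''head'') (Set_var ''v'' (N 0))) s'
      (80 * (m + 1) + 3) Q" if "same s'" "b < d" for s'
  proof (rule exchange_case[OF that(1)])
    fix k' :: "nat \<Rightarrow> nat"
    assume "\<And>j. j < m \<Longrightarrow> k' j = (if s ''tail'' j = v then 0 else if s ''head'' j = v then 1
          else s ''keep'' j)"
    then have "selected es k' = exchange_out A F v"
      unfolding A_def F_def by (intro selected_exchange_out dist) (auto simp: enc m_def[symmetric])
    then show "acyclic (A - selected es k') \<and> card (selected es k') < card F"
      using acyclic_exchange_out[OF acyc] card_exchange_less[OF fin] that(2)
      by (simp add: exchange_out_def b_def d_def)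
  qed auto

  have next_case: "runs (Incr ''v'') s' 6 Q" if s': "same s'" and "\<not> a < d" "\<not> b < d" for s'
  proof (rule runs_Assign)
    let ?t = "s'(''v'' := (s' ''v'')(0 := Suc v))"
    have eq: "s' ''v'' 0 = v" "s' ''keep'' = s ''keep''" using s' by (auto simp: same_def v_def)
    have "encodes n es ?t" using encs s' by (simp add: encodes_def same_def)
    moreover have "locally_sparse A F v"
      using that by (simp add: locally_sparse_def a_def b_def d_def)
    ultimately have "search_inv n es ?t"
      using eq acyc sparse less by (auto simp: search_inv_def A_def F_def v_def less_Suc_eq)
    moreover have "search_measure n es ?t < search_measure n es s"
      using eq less by (simp add: search_measure_def v_def)
    ultimately show "Q (s'(''v'' := (s' ''v'')(aval (N 0) s' := aval (Plus (Var ''v'') (N 1)) s')))"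
      using eq by (simp add: Q_def)
  qed simp

  have antisym: "\<not> i < j \<and> \<not> j < i \<longleftrightarrow> i = j" for i j :: nat by auto
  let ?c = "80 * (m + 1)"
  \<comment> \<open>The summands are three counting loops, two tests of cost 6, and an exchange loop
    followed by a reset of cost 3.\<close>
  have "runs improve s (?c + (?c + (?c + (6 + (6 + (?c + 3)))))) Q"
    unfolding improve_def
  proof (rule runs_Seq[OF runs_count_arcs[where m = m and
          Q = "\<lambda>j. s ''keep'' j = 0 \<and> (fst (es ! j) = v \<or> snd (es ! j) = v)"],
          where Td = "?c + (?c + (6 + (6 + (?c + 3))))"], goal_cases)
    \<comment> \<open>The sixth goal is the rest of the program after the count; the premises of
      \<open>runs_count_arcs\<close> and the arithmetic are discharged at the end.\<close>
    case (6 s1)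
    then have s1: "same s1" "s1 ''deg'' 0 = d" by (auto simp: same_def d)
    show ?case
    proof (rule runs_Seq[OF runs_count_arcs[where m = m and Q = "\<lambda>j. snd (es ! j) = v"],
            where Td = "?c + (6 + (6 + (?c + 3)))"], goal_cases)
      case (6 s2)
      then have s2: "same s2" "s2 ''deg'' 0 = d" "s2 ''indeg'' 0 = a"
        using s1 by (auto simp: same_def a)
      show ?case
      proof (rule runs_Seq[OF runs_count_arcs[where m = m and Q = "\<lambda>j. fst (es ! j) = v"],
              where Td = "6 + (6 + (?c + 3))"], goal_cases)
        case (6 s3)
        then have s3: "same s3" "s3 ''deg'' 0 = d" "s3 ''indeg'' 0 = a" "s3 ''outdeg'' 0 = b"
          using s2 by (auto simp: same_def b)
        show ?case
        proof (rule runs_Cond[where T' = "6 + (?c + 3)"], goal_cases)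
          case 1
          then show ?case using s3
            by (intro runs_mono[OF in_case, where T' = "6 + (?c + 3)"]) auto
        next
          case 2
          then show ?case using s3
            by (intro runs_Cond[where T' = "?c + 3"] out_case runs_mono[OF next_case]) auto
        qed simp
      qed (use s2 enc in \<open>simp_all add: same_def v_def antisym\<close>)
    qed (use s1 enc in \<open>simp_all add: same_def v_def antisym\<close>)
  qed (use enc in \<open>simp_all add: v_def antisym\<close>)
  then show ?thesis by (rule runs_mono) (auto simp: Q_def m_def)
qed

section \<open>Output of the selected arcs\<close>

lemma runs_emit:
  assumes enc: "encodes n es s" and outm: "s ''outm'' 0 = 0"
  shows "runs emit s (80 * (length es + 1))
    (\<lambda>s'. output_arcs s' = map ((!) es) (filter (\<lambda>j. s ''keep'' j = 0) [0..<length es]))"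
proof -
  define P where "P k s' \<longleftrightarrow>
    output_arcs s' = map ((!) es) (filter (\<lambda>j. s ''keep'' j = 0) [0..<k]) \<and>
    (\<forall>x. x \<notin> {''outtail'', ''outhead'', ''outm'', ''i''} \<longrightarrow> s' x = s x)" for k and s' :: store
  have "runs emit s (3 + (length es + 1) * (40 + 12)) (P (length es))"
    unfolding emit_def
  proof (rule runs_for_arcs)
    fix j s' assume *: "j < length es" "s' ''i'' 0 = j" "s' ''m'' 0 = length es" "P j s'"
    define k where "k = s' ''outm'' 0"
    have eq: "s' ''keep'' j = s ''keep'' j" "s' ''tail'' j = fst (es ! j)" "s' ''head'' j = snd (es ! j)"
      using * enc by (auto simp: P_def encodes_def)
    define s1 where "s1 = s'(''outtail'' := (s' ''outtail'')(k := fst (es ! j)))"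
    define s2 where "s2 = s1(''outhead'' := (s1 ''outhead'')(k := snd (es ! j)))"
    define s3 where "s3 = s2(''outm'' := (s2 ''outm'')(0 := Suc k))"
    \<comment> \<open>The arc is written to cell \<open>k\<close>, just past the old output, and
      raising \<open>outm\<close> afterwards makes it the last entry of the list.\<close>
    have "output_arcs (s3(''i'' := f)) = output_arcs s' @ [es ! j]" for f
      by (auto simp: output_arcs_def s3_def s2_def s1_def k_def)
    moreover have "s3 x = s' x" if "x \<notin> {''outtail'', ''outhead'', ''outm'', ''i''}" for x
      using that by (simp add: s3_def s2_def s1_def)
    ultimately have yes: "P (Suc j) (s3(''i'' := f))" if "s ''keep'' j = 0" for f
      using *(4) that by (auto simp: P_def)
    have no: "P (Suc j) (s'(''i'' := f))" if "s ''keep'' j \<noteq> 0" for f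
      using *(4) that by (auto simp: P_def output_arcs_def)
    show "runs (Cond (Eq (Rd ''keep'' (Var ''i'')) (N 0))
       (Seq (Assign ''outtail'' (Var ''outm'') (Rd ''tail'' (Var ''i'')))
       (Seq (Assign ''outhead'' (Var ''outm'') (Rd ''head'' (Var ''i'')))
       (Incr ''outm''))) Skip) s' 40
       (\<lambda>s'. s' ''i'' 0 = j \<and> s' ''m'' 0 = length es \<and>
         P (Suc j) (s'(''i'' := (s' ''i'')(0 := Suc j))))"
    proof (rule runs_Cond[where T' = 20], goal_cases)
      case 1
      then have "s ''keep'' j = 0" using * eq by simp
      have 1: "runs (Assign ''outtail'' (Var ''outm'') (Rd ''tail'' (Var ''i''))) s' 6 (\<lambda>s. s = s1)"
        using * eq by (intro runs_Assign) (simp_all add: s1_def k_def)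
      have 2: "runs (Assign ''outhead'' (Var ''outm'') (Rd ''head'' (Var ''i''))) s1 6 (\<lambda>s. s = s2)"
        using * eq by (intro runs_Assign) (simp_all add: s2_def s1_def k_def)
      have "s3 ''i'' = s' ''i''" "s3 ''m'' = s' ''m''" by (simp_all add: s3_def s2_def s1_def)
      then have "s3 ''i'' 0 = j \<and> s3 ''m'' 0 = length es \<and>
          P (Suc j) (s3(''i'' := (s3 ''i'')(0 := Suc j)))"
        using * yes \<open>s ''keep'' j = 0\<close> by simp
      moreover have "s2(''outm'' := (s2 ''outm'')(aval (N 0) s2 :=
          aval (Plus (Var ''outm'') (N 1)) s2)) = s3"
        by (simp add: s3_def s2_def s1_def k_def)
      ultimately have 3: "runs (Incr ''outm'') s2 6 (\<lambda>s'. s' ''i'' 0 = j \<and> s' ''m'' 0 = length es \<and>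
          P (Suc j) (s'(''i'' := (s' ''i'')(0 := Suc j))))"
        by (intro runs_Assign) simp_all
      show ?case
      proof (rule runs_Seq[OF 1, where Td = 12], goal_cases)
        case (1 t)
        show ?case
          unfolding 1 by (rule runs_Seq[OF 2, where Td = 6]) (use 3 in simp_all)
      qed simp
    next
      case 2
      then show ?case using * eq no by (intro runs_Skip) auto
    qed simp
  qed (use assms in \<open>auto simp: P_def output_arcs_def encodes_def\<close>)
  then show ?thesis by (rule runs_mono) (auto simp: P_def)
qed

section \<open>Correctness of the whole program and its cubic bound\<close>

lemma runs_local_search:
  assumes dist: "distinct es"
  shows "runs local_search (input_store n es) (500 * (1 + (n + length es)) ^ 3) (\<lambda>s.
    distinct (output_arcs s) \<and> set (output_arcs s) \<subseteq> set es \<and>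
    acyclic (set es - set (output_arcs s)) \<and>
    (\<forall>v < n. locally_sparse (set es) (set (output_arcs s)) v))"
    (is "runs _ ?s _ ?R")
proof -
  define M where "M = 1 + (n + length es)"
  let ?cost = "6 + 400 * (length es + 1)"
  have sel: "selected es (?s ''keep'') = set es"
    unfolding selected_def set_conv_nth by (auto simp: input_store_def)
  have "search_inv n es ?s"
    unfolding search_inv_def sel by (simp add: encodes_def input_store_def acyclic_def)
  then have "runs (While (Less (Var ''v'') (Var ''n'')) improve) ?s
      ((search_measure n es ?s + 1) * (1 + bcost (Less (Var ''v'') (Var ''n'')) + 400 * (length es + 1)))
      (\<lambda>s. search_inv n es s \<and> \<not> bval (Less (Var ''v'') (Var ''n'')) s)"
    by (intro runs_While[where \<mu> = "search_measure n es"] runs_improve dist)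
      (auto simp: search_inv_def encodes_def)
  then have search: "runs (While (Less (Var ''v'') (Var ''n'')) improve) ?s
      (406 * M ^ 3) (\<lambda>s. search_inv n es s \<and> s ''v'' 0 = n)"
  proof (rule runs_mono)
    \<comment> \<open>Initially all arcs are selected and the scan is at 0. This gives at most
      \<open>M * M\<close> rounds, counting the final test, each of cost at most
      \<open>406 * M\<close>.\<close>
    have "search_measure n es ?s + 1 = (length es + 1) * (n + 1)"
      unfolding search_measure_def sel
      using distinct_card[OF dist] by (simp add: input_store_def)
    also have "\<dots> \<le> M * M" unfolding M_def by (intro mult_mono) auto
    finally have "(search_measure n es ?s + 1) * ?cost \<le> (M * M) * (406 * M)"
      by (rule mult_mono) (auto simp: M_def)
    then show "(search_measure n es ?s + 1) *
        (1 + bcost (Less (Var ''v'') (Var ''n'')) + 400 * (length es + 1)) \<le> 406 * M ^ 3"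
      by (simp add: power3_eq_cube algebra_simps)
  qed (auto simp: search_inv_def encodes_def)
  have emit: "runs (Seq (Set_var ''outm'' (N 0)) emit) s (94 * M ^ 3) ?R"
    if inv: "search_inv n es s \<and> s ''v'' 0 = n" for s
  proof -
    let ?t = "s(''outm'' := (s ''outm'')(0 := 0))"
    have "encodes n es ?t"
      using inv by (simp add: search_inv_def encodes_def)
    then have "runs emit ?t (80 * (length es + 1)) (\<lambda>s'. output_arcs s' =
        map ((!) es) (filter (\<lambda>j. ?t ''keep'' j = 0) [0..<length es]))"
      by (rule runs_emit) simp
    then have "runs emit ?t (80 * M) ?R"
    proof (rule runs_mono)
      fix s' assume out: "output_arcs s' =
        map ((!) es) (filter (\<lambda>j. ?t ''keep'' j = 0) [0..<length es])"
      then have "set (output_arcs s') = selected es (s ''keep'')"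
        by (auto simp: selected_def)
      moreover have "distinct (output_arcs s')"
        unfolding out using dist by (auto simp: distinct_map intro!: inj_on_nth)
      ultimately show "?R s'" using inv selected_subset[of es] by (auto simp: search_inv_def)
    qed (auto simp: M_def)
    then have "runs (Seq (Set_var ''outm'' (N 0)) emit) s (3 + 80 * M) ?R"
      by (intro runs_Seq[where Tc = 3 and P = "\<lambda>s'. s' = ?t"] runs_Assign) auto
    \<comment> \<open>The 94 is what the search, at 406, leaves of the announced 500.\<close>
    moreover have "3 + 80 * M \<le> 94 * M ^ 3"
    proof -
      have "1 \<le> M" by (simp add: M_def)
      moreover from this have "M \<le> M ^ 3" by (intro self_le_power) auto
      ultimately show ?thesis by linarith
    qed
    ultimately show ?thesis by (rule runs_mono) auto
  qed
  show ?thesis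
    unfolding local_search_def M_def[symmetric]
    by (rule runs_Seq[OF search emit]) auto
qed

lemma poly_time_solvable_sparse_feedback_arc_set: "poly_time_solvable sparse_feedback_arc_set"
  unfolding poly_time_solvable_def
\<comment> \<open>\<open>[:1, 1:]\<close> is the polynomial 1 + X, evaluated at the number of
  vertices plus arcs.\<close>
proof (intro exI[of _ local_search] exI[of _ "smult 500 ([:1, 1:] ^ 3)"] allI impI)
  fix D :: "nat pair_pre_digraph" and n es
  assume D: "pair_digraph D \<and> pverts D = {0..<n} \<and> distinct es \<and> set es = parcs D"
  then have "digraph_size D = n + length es"
    using distinct_card[of es] by (simp add: digraph_size_def)
  moreover obtain t s where run: "exec local_search (input_store n es) t s"
      "t \<le> 500 * (1 + (n + length es)) ^ 3"
    and out: "distinct (output_arcs s)" "set (output_arcs s) \<subseteq> set es"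
      "acyclic (set es - set (output_arcs s))"
      "\<forall>v < n. locally_sparse (set es) (set (output_arcs s)) v"
    using runs_local_search[of es n] D unfolding runs_def by blast
  moreover have "sparse_feedback_arc_set D (set (output_arcs s))"
    using D out by (intro sparse_feedback_arc_setI) (auto simp: locally_sparse_def)
  ultimately show "\<exists>t s. exec local_search (input_store n es) t s \<and>
      t \<le> poly (smult 500 ([:1, 1:] ^ 3)) (digraph_size D) \<and>
      distinct (output_arcs s) \<and> sparse_feedback_arc_set D (set (output_arcs s))"
    by (intro exI[of _ t] exI[of _ s]) (simp add: poly_power)
qed

theorem theorem2p2:
  shows "(\<forall>D :: 'a pair_pre_digraph. pair_digraph D \<longrightarrow> (\<exists>F. sparse_feedback_arc_set D F)) \<and>
    poly_time_solvable sparse_feedback_arc_set"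
  using ex_sparse_feedback_arc_set poly_time_solvable_sparse_feedback_arc_set by blast

end
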